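(* Let $\bar A\in\mathbb{R}^{n\times n}$, $\bar B\in\mathbb{R}^{n\times m}$, $\bar E\in\mathbb{R}^{n\times q}$, $\bar C_1\in\mathbb{R}^{r\times n}$, $\bar D_1\in\mathbb{R}^{r\times q}$, $\bar C_2\in\mathbb{R}^{p\times n}$, $\bar D_2\in\mathbb{R}^{p\times m}$ be real matrices such that $(\bar A,\bar B)$ is stabilizable and $(\bar C_1,\bar A)$ is detectable, and consider the system $\dot x=\bar A x+\bar B u+\bar E d$, $y=\bar C_1x+\bar D_1 d$, $z=\bar C_2x+\bar D_2u$. Let $\gamma>0$. Assume that $\bar D_1\bar E^\top=0$, $\bar D_2^\top\bar C_2=0$, $\bar D_1\bar D_1^\top=I_r$ and $\bar D_2^\top\bar D_2>0$. Suppose that there exist real symmetric $n\times n$ matrices $P>0$ and $Q>0$ satisfying $$\bar A^\top P+P\bar A-P\bar B(\bar D_2^\top\bar D_2)^{-1}\bar B^\top P+\bar C_2^\top\bar C_2<0,$$ $$\bar A Q+Q\bar A^\top-Q\bar C_1^\top\bar C_1Q+\bar E\bar E^\top<0,$$ $$\operatorname{tr}\left(\bar C_1QPQ\bar C_1^\top\right)+\operatorname{tr}\left(\bar C_2Q\bar C_2^\top\right)<\gamma.$$ Let $G=Q\bar C_1^\top$ and $F=-(\bar D_2^\top\bar D_2)^{-1}\bar B^\top P$. Then the controller $\dot w=\bar A w+\bar B u+G(y-\bar C_1w)$, $u=Fw$ internally stabilizes the system, and it is suboptimal, i.e. $J(F,G)<\gamma$.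
   Context: For symmetric $M$, $M>0$ (resp. $M<0$) means positive (resp. negative) definite. A square matrix is Hurwitz if all its eigenvalues have negative real part. Interconnecting the system with the controller $\dot w=\bar A w+\bar B u+G(y-\bar C_1w)$, $u=Fw$ (with $F\in\mathbb{R}^{m\times n}$, $G\in\mathbb{R}^{n\times r}$, $w\in\mathbb{R}^n$) gives the closed loop system with state $(x,w)$, input $d$ and output $z$: $$\begin{pmatrix}\dot x\\ \dot w\end{pmatrix}=A_a\begin{pmatrix}x\\ w\end{pmatrix}+E_a d,\quad z=C_a\begin{pmatrix}x\\ w\end{pmatrix},$$ $$A_a=\begin{pmatrix}\bar A&\bar BF\\ G\bar C_1&\bar A+\bar BF-G\bar C_1\end{pmatrix},\quad E_a=\begin{pmatrix}\bar E\\ G\bar D_1\end{pmatrix},\quad C_a=\begin{pmatrix}\bar C_2&\bar D_2F\end{pmatrix}.$$ The controller internally stabilizes the system (the closed loop is internally stable) if $A_a$ is Hurwitz. The $\mathcal{H}_2$ cost is $$J(F,G)=\int_0^\infty\operatorname{tr}\left[T_{F,G}^\top(t)T_{F,G}(t)\right]dt,\qquad T_{F,G}(t)=C_ae^{A_at}E_a.$$ *)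

theory Defs
  imports "HOL-Analysis.Analysis"
begin

(* Throughout, a matrix with a rows and b columns has type real ^ 'b ^ 'a. *)

definition symmetric_matrix :: "real ^ 'n ^ 'n \<Rightarrow> bool" where
  "symmetric_matrix M \<longleftrightarrow> transpose M = M"

definition pos_def :: "real ^ 'n ^ 'n \<Rightarrow> bool" where
  "pos_def M \<longleftrightarrow> symmetric_matrix M \<and> (\<forall>x. x \<noteq> 0 \<longrightarrow> 0 < x \<bullet> (M *v x))"

definition neg_def :: "real ^ 'n ^ 'n \<Rightarrow> bool" where
  "neg_def M \<longleftrightarrow> symmetric_matrix M \<and> (\<forall>x. x \<noteq> 0 \<longrightarrow> x \<bullet> (M *v x) < 0)"

definition eigenvalue :: "complex ^ 'n ^ 'n \<Rightarrow> complex \<Rightarrow> bool" where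
  "eigenvalue M \<mu> \<longleftrightarrow> (\<exists>v. v \<noteq> 0 \<and> M *v v = \<mu> *s v)"

(* The eigenvalues of a real matrix are its complex ones. *)
definition hurwitz :: "real ^ 'n ^ 'n \<Rightarrow> bool" where
  "hurwitz M \<longleftrightarrow> (\<forall>\<mu>. eigenvalue (map_matrix complex_of_real M) \<mu> \<longrightarrow> Re \<mu> < 0)"

definition stabilizable :: "real ^ 'n ^ 'n \<Rightarrow> real ^ 'm ^ 'n \<Rightarrow> bool" where
  "stabilizable A B \<longleftrightarrow> (\<exists>F :: real ^ 'n ^ 'm. hurwitz (A + B ** F))"

definition detectable :: "real ^ 'n ^ 'r \<Rightarrow> real ^ 'n ^ 'n \<Rightarrow> bool" where
  "detectable C A \<longleftrightarrow> (\<exists>G :: real ^ 'r ^ 'n. hurwitz (A - G ** C))"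

(* The type class power on real ^ 'n ^ 'n is componentwise, and exp is not available there,
   so the matrix exponential is defined by its power series. *)
definition matrix_power :: "real ^ 'n ^ 'n \<Rightarrow> nat \<Rightarrow> real ^ 'n ^ 'n" where
  "matrix_power M k = ((\<lambda>X. M ** X) ^^ k) (mat 1)"

definition matrix_exp :: "real ^ 'n ^ 'n \<Rightarrow> real ^ 'n ^ 'n" where
  "matrix_exp M = (\<Sum>k. (1 / fact k) *\<^sub>R matrix_power M k)"

(* Block matrices are indexed by sum types: Inl is the first block, Inr the second. *)
definition hblock :: "real ^ 'c ^ 'a \<Rightarrow> real ^ 'd ^ 'a \<Rightarrow> real ^ ('c + 'd) ^ 'a" where
  "hblock X Y = (\<chi> i j. case j of Inl k \<Rightarrow> X $ i $ k | Inr k \<Rightarrow> Y $ i $ k)"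

definition vblock :: "real ^ 'c ^ 'a \<Rightarrow> real ^ 'c ^ 'b \<Rightarrow> real ^ 'c ^ ('a + 'b)" where
  "vblock X Y = (\<chi> i j. case i of Inl k \<Rightarrow> X $ k $ j | Inr k \<Rightarrow> Y $ k $ j)"

(* Closed loop of  x' = A x + B u + E d,  y = C1 x + D1 d,  z = C2 x + D2 u  with the controller
   w' = A w + B u + G (y - C1 w),  u = F w,  in the state (x, w). *)
definition closed_loop_A ::
  "real ^ 'n ^ 'n \<Rightarrow> real ^ 'm ^ 'n \<Rightarrow> real ^ 'n ^ 'r \<Rightarrow> real ^ 'n ^ 'm \<Rightarrow> real ^ 'r ^ 'n
     \<Rightarrow> real ^ ('n + 'n) ^ ('n + 'n)" where
  "closed_loop_A A B C1 F G =
     vblock (hblock A (B ** F))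
            (hblock (G ** C1) (A + B ** F - G ** C1))"

definition closed_loop_E ::
  "real ^ 'q ^ 'n \<Rightarrow> real ^ 'q ^ 'r \<Rightarrow> real ^ 'r ^ 'n \<Rightarrow> real ^ 'q ^ ('n + 'n)" where
  "closed_loop_E E D1 G = vblock E (G ** D1)"

definition closed_loop_C ::
  "real ^ 'n ^ 'p \<Rightarrow> real ^ 'm ^ 'p \<Rightarrow> real ^ 'n ^ 'm \<Rightarrow> real ^ ('n + 'n) ^ 'p" where
  "closed_loop_C C2 D2 F = hblock C2 (D2 ** F)"

definition internally_stabilizes ::
  "real ^ 'n ^ 'n \<Rightarrow> real ^ 'm ^ 'n \<Rightarrow> real ^ 'n ^ 'r \<Rightarrow> real ^ 'n ^ 'm \<Rightarrow> real ^ 'r ^ 'n \<Rightarrow> bool" where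
  "internally_stabilizes A B C1 F G \<longleftrightarrow> hurwitz (closed_loop_A A B C1 F G)"

definition impulse_response ::
  "real ^ 'n ^ 'n \<Rightarrow> real ^ 'm ^ 'n \<Rightarrow> real ^ 'q ^ 'n \<Rightarrow> real ^ 'n ^ 'r \<Rightarrow> real ^ 'q ^ 'r
     \<Rightarrow> real ^ 'n ^ 'p \<Rightarrow> real ^ 'm ^ 'p \<Rightarrow> real ^ 'n ^ 'm \<Rightarrow> real ^ 'r ^ 'n \<Rightarrow> real \<Rightarrow> real ^ 'q ^ 'p" where
  "impulse_response A B E C1 D1 C2 D2 F G t =
     closed_loop_C C2 D2 F ** matrix_exp (t *\<^sub>R closed_loop_A A B C1 F G) ** closed_loop_E E D1 G"

(* The integrand is nonnegative, so the integral is taken in [0, infinity]: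
   a divergent cost is infinite, and a bound on the cost includes its convergence. *)
definition H2_cost ::
  "real ^ 'n ^ 'n \<Rightarrow> real ^ 'm ^ 'n \<Rightarrow> real ^ 'q ^ 'n \<Rightarrow> real ^ 'n ^ 'r \<Rightarrow> real ^ 'q ^ 'r
     \<Rightarrow> real ^ 'n ^ 'p \<Rightarrow> real ^ 'm ^ 'p \<Rightarrow> real ^ 'n ^ 'm \<Rightarrow> real ^ 'r ^ 'n \<Rightarrow> ennreal" where
  "H2_cost A B E C1 D1 C2 D2 F G =
     (\<integral>\<^sup>+ t \<in> {0..}. ennreal (trace (transpose (impulse_response A B E C1 D1 C2 D2 F G t)
                                      ** impulse_response A B E C1 D1 C2 D2 F G t)) \<partial>lborel)"

end

theory Submission
  imports Defs
begin

text \<open>In the coordinates \<open>e = x - w\<close>, \<open>w\<close> the closed loop is block triangular with diagonal blocks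
  \<open>A - G C1\<close> and \<open>A + B F\<close>, and the two Riccati inequalities say that \<open>Q\<close> and \<open>P\<close> are Lyapunov
  matrices for these blocks; this gives stability. For the cost, let \<open>S \<ge> 0\<close> solve
  \<open>(A + B F) S + S (A + B F)\<^sup>T + G G\<^sup>T = 0\<close>. Since \<open>C1 Q = G\<^sup>T\<close>, the cross terms cancel and
  \<open>X = diag(Q, S)\<close> satisfies \<open>M X + X M\<^sup>T + E E\<^sup>T \<le> 0\<close> for the closed loop, so that
  \<open>tr (C e\<^bsup>tM\<^esup> X e\<^bsup>tM\<^esup>\<^sup>T C\<^sup>T)\<close> decreases at least at the rate of the cost integrand and
  \<open>J \<le> tr (C X C\<^sup>T) = tr (C2 Q C2\<^sup>T) + tr ((C2 + D2 F) S (C2 + D2 F)\<^sup>T)\<close>. Pairing the Riccati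
  inequality for \<open>P\<close> with \<open>S\<close> bounds the last trace by \<open>tr (P G G\<^sup>T) = tr (C1 Q P Q C1\<^sup>T)\<close>.\<close>

section \<open>Inner products, transposes and traces\<close>

declare transpose_matrix_vector [simp del]

text \<open>Matrices are moved across inner products by this rule, for which products with a
  transpose must keep the form \<open>transpose M *v y\<close>; hence the deleted simp rule.\<close>

lemma inner_matrix_vector_mult_left:
  fixes M :: "real ^ 'b ^ 'a"
  shows "(M *v x) \<bullet> y = x \<bullet> (transpose M *v y)"
  by (metis dot_lmul_matrix vector_transpose_matrix)

lemma symmetric_matrix_inner_swap:
  assumes "symmetric_matrix S"
  shows "x \<bullet> (S *v y) = y \<bullet> (S *v x)"
  using assms inner_matrix_vector_mult_left[of S x y]
  by (simp add: symmetric_matrix_def inner_commute)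

lemma matrix_vector_mult_uminus_left:
  fixes M :: "real ^ 'b ^ 'a"
  shows "(- M) *v x = - (M *v x)"
  by (simp add: vec_eq_iff matrix_vector_mult_def sum_negf)

text \<open>Each diagonal entry of the product is the form of \<open>X\<close> at a row of
  \<open>C\<close>, so the traces in the cost can be handled through quadratic forms.\<close>

lemma trace_congruence:
  fixes C :: "real ^ 'k ^ 'p" and X :: "real ^ 'k ^ 'k"
  shows "trace (C ** X ** transpose C) = (\<Sum>i\<in>UNIV. (C $ i) \<bullet> (X *v (C $ i)))"
proof -
  have "(C ** X ** transpose C) $ i $ i = (C $ i) \<bullet> (X *v (C $ i))" for i
  proof -
    have "(C ** X ** transpose C) $ i $ i = (C ** (X ** transpose C)) $ i $ i"
      by (simp add: matrix_mul_assoc)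
    also have "\<dots> = (C $ i) \<bullet> (X *v (C $ i))"
      by (simp add: matrix_matrix_mult_def transpose_def inner_vec_def matrix_vector_mult_def)
    finally show ?thesis .
  qed
  then show ?thesis
    by (simp add: trace_def)
qed

lemma trace_transpose_mult_self:
  fixes T :: "real ^ 'q ^ 'p"
  shows "trace (transpose T ** T) = (\<Sum>i\<in>UNIV. (norm (T $ i))\<^sup>2)"
  using trace_congruence[of T "mat 1"]
  by (simp add: trace_mul_sym[of "transpose T"] power2_norm_eq_inner)

lemma matrix_matrix_mult_row:
  fixes M :: "real ^ 'b ^ 'a" and N :: "real ^ 'c ^ 'b"
  shows "(M ** N) $ i = transpose N *v (M $ i)"
  by (simp add: vec_eq_iff matrix_matrix_mult_def matrix_vector_mult_def transpose_def mult.commute)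

section \<open>The matrix exponential\<close>

lemma matrix_power_0: "matrix_power M 0 = mat 1"
  by (simp add: matrix_power_def)

lemma matrix_power_Suc: "matrix_power M (Suc k) = M ** matrix_power M k"
  by (simp add: matrix_power_def)

lemma matrix_power_Suc_right: "matrix_power M (Suc k) = matrix_power M k ** M"
proof (induction k)
  case 0
  show ?case by (simp add: matrix_power_0 matrix_power_Suc)
next
  case (Suc k)
  then show ?case by (metis matrix_power_Suc matrix_mul_assoc)
qed

lemma matrix_power_scaleR: "matrix_power (t *\<^sub>R M) k = t ^ k *\<^sub>R matrix_power M k"
  by (induction k)
    (simp_all add: matrix_power_0 matrix_power_Suc matrix_scalar_ac scalar_matrix_assoc[symmetric])

text \<open>An entry of a product is a sum of \<open>CARD('n)\<close> terms, so each further factor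
  costs at most \<open>CARD('n) * c\<close>. This geometric growth is dominated by the factorials of
  the exponential series.\<close>

lemma matrix_power_entry_bound:
  fixes M :: "real ^ 'n ^ 'n" and c :: real
  assumes "\<And>i j. \<bar>M $ i $ j\<bar> \<le> c"
  shows "\<bar>matrix_power M k $ i $ j\<bar> \<le> (CARD('n) * c) ^ k"
proof (induction k arbitrary: i j)
  case 0
  show ?case by (simp add: matrix_power_0 mat_def)
next
  case (Suc k)
  have c: "0 \<le> c" using assms[of i j] by linarith
  have "\<bar>matrix_power M (Suc k) $ i $ j\<bar> \<le> (\<Sum>l\<in>UNIV. \<bar>M $ i $ l * matrix_power M k $ l $ j\<bar>)"
    unfolding matrix_power_Suc by (simp add: matrix_matrix_mult_def sum_abs)
  also have "\<dots> \<le> (\<Sum>l\<in>(UNIV::'n set). c * (CARD('n) * c) ^ k)"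
    by (intro sum_mono) (auto simp: abs_mult intro!: mult_mono assms Suc c)
  also have "\<dots> = (CARD('n) * c) ^ Suc k" by simp
  finally show ?case .
qed

lemma matrix_exp_entry_summable:
  fixes M :: "real ^ 'n ^ 'n"
  shows "summable (\<lambda>k. matrix_power M k $ i $ j / fact k * t ^ k)"
proof -
  define c where "c = (\<Sum>i\<in>UNIV. \<Sum>j\<in>UNIV. \<bar>M $ i $ j\<bar>)"
  have c: "\<bar>M $ i $ j\<bar> \<le> c" for i j
  proof -
    have "\<bar>M $ i $ j\<bar> \<le> (\<Sum>j\<in>UNIV. \<bar>M $ i $ j\<bar>)"
      by (rule member_le_sum) auto
    also have "\<dots> \<le> c"
      unfolding c_def by (rule member_le_sum[where f = "\<lambda>i. \<Sum>j\<in>UNIV. \<bar>M $ i $ j\<bar>"]) (auto intro: sum_nonneg)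
    finally show ?thesis .
  qed
  show ?thesis
  proof (rule summable_comparison_test')
    show "summable (\<lambda>k. inverse (fact k) * (CARD('n) * c * \<bar>t\<bar>) ^ k)"
      by (rule summable_exp)
    show "norm (matrix_power M k $ i $ j / fact k * t ^ k)
        \<le> inverse (fact k) * (CARD('n) * c * \<bar>t\<bar>) ^ k" if "k \<ge> 0" for k
      using mult_right_mono[OF matrix_power_entry_bound[OF c, of k i j], of "\<bar>t\<bar> ^ k / fact k"]
      by (simp add: abs_mult power_mult_distrib power_abs field_simps)
  qed
qed

text \<open>Convergence of matrices is entrywise, so each entry of
  \<open>matrix_exp (t *\<^sub>R M)\<close> is a scalar power series in \<open>t\<close>, open to
  termwise differentiation.\<close>

lemma matrix_exp_entry:
  fixes M :: "real ^ 'n ^ 'n"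
  shows "matrix_exp (t *\<^sub>R M) $ i $ j = (\<Sum>k. matrix_power M k $ i $ j / fact k * t ^ k)"
proof -
  have "(\<lambda>k. (1 / fact k) *\<^sub>R matrix_power (t *\<^sub>R M) k)
      sums (\<chi> i j. \<Sum>k. matrix_power M k $ i $ j / fact k * t ^ k)"
    unfolding sums_def
  proof (intro vec_tendstoI)
    fix i j
    show "(\<lambda>n. (\<Sum>k<n. (1 / fact k) *\<^sub>R matrix_power (t *\<^sub>R M) k) $ i $ j)
        \<longlonglongrightarrow> (\<chi> i j. \<Sum>k. matrix_power M k $ i $ j / fact k * t ^ k) $ i $ j"
      using summable_LIMSEQ[OF matrix_exp_entry_summable[of M i j t]]
      by (simp add: matrix_power_scaleR mult.commute)
  qed
  then have "matrix_exp (t *\<^sub>R M) = (\<chi> i j. \<Sum>k. matrix_power M k $ i $ j / fact k * t ^ k)"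
    unfolding matrix_exp_def by (simp add: sums_unique[symmetric])
  then show ?thesis by simp
qed

lemma matrix_exp_0:
  fixes M :: "real ^ 'n ^ 'n"
  shows "matrix_exp (0 *\<^sub>R M) = mat 1"
  unfolding vec_eq_iff matrix_exp_entry powser_zero by (simp add: matrix_power_0)

text \<open>The factor \<open>M\<close> is split off on the right because the rows of
  \<open>C ** matrix_exp (t *\<^sub>R M)\<close> are followed later: as vectors they are moved by
  \<open>transpose M\<close>.\<close>

lemma matrix_exp_entry_deriv:
  fixes M :: "real ^ 'n ^ 'n"
  shows "((\<lambda>t. matrix_exp (t *\<^sub>R M) $ i $ j) has_real_derivative
           (matrix_exp (t *\<^sub>R M) ** M) $ i $ j) (at t)"
proof -
  define c where "c l k = matrix_power M k $ i $ l / fact k" for l k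
  have "((\<lambda>t. \<Sum>k. c j k * t ^ k) has_real_derivative (\<Sum>k. diffs (c j) k * t ^ k)) (at t)"
    by (rule termdiffs_strong_converges_everywhere) (unfold c_def, rule matrix_exp_entry_summable)
  moreover have "(\<Sum>k. diffs (c j) k * t ^ k) = (matrix_exp (t *\<^sub>R M) ** M) $ i $ j"
  proof -
    \<comment> \<open>The factor \<open>k + 1\<close> from differentiation cancels against the
      factorial, and the remaining power splits as \<open>matrix_power M k ** M\<close>.\<close>
    have "diffs (c j) k * t ^ k = (\<Sum>l\<in>UNIV. c l k * t ^ k * M $ l $ j)" for k
    proof -
      have "diffs (c j) k = (matrix_power M k ** M) $ i $ j / fact k"
        by (simp add: diffs_def c_def matrix_power_Suc_right field_simps del: of_nat_Suc)
      then show ?thesis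
        by (simp add: c_def matrix_matrix_mult_def sum_divide_distrib sum_distrib_left sum_distrib_right mult_ac)
    qed
    then have "(\<Sum>k. diffs (c j) k * t ^ k) = (\<Sum>k. \<Sum>l\<in>UNIV. c l k * t ^ k * M $ l $ j)"
      by simp
    also have "\<dots> = (\<Sum>l\<in>UNIV. \<Sum>k. c l k * t ^ k * M $ l $ j)"
      by (intro suminf_sum summable_mult2) (unfold c_def, rule matrix_exp_entry_summable)
    also have "\<dots> = (\<Sum>l\<in>UNIV. (\<Sum>k. c l k * t ^ k) * M $ l $ j)"
      by (intro sum.cong refl suminf_mult2[symmetric]) (unfold c_def, rule matrix_exp_entry_summable)
    also have "\<dots> = (matrix_exp (t *\<^sub>R M) ** M) $ i $ j"
      by (simp add: matrix_matrix_mult_def matrix_exp_entry c_def)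
    finally show ?thesis .
  qed
  ultimately show ?thesis
    unfolding matrix_exp_entry c_def[symmetric] by simp
qed

lemma transpose_matrix_exp_deriv:
  fixes M :: "real ^ 'n ^ 'n"
  shows "((\<lambda>t. transpose (matrix_exp (t *\<^sub>R M)) *v v) has_vector_derivative
           transpose M *v (transpose (matrix_exp (t *\<^sub>R M)) *v v)) (at t)"
proof -
  have "((\<lambda>t. (transpose (matrix_exp (t *\<^sub>R M)) *v v) $ i) has_real_derivative
           (transpose M *v (transpose (matrix_exp (t *\<^sub>R M)) *v v)) $ i) (at t)" for i
  proof -
    have "((\<lambda>t. \<Sum>j\<in>UNIV. matrix_exp (t *\<^sub>R M) $ j $ i * v $ j) has_real_derivative
           (\<Sum>j\<in>UNIV. (matrix_exp (t *\<^sub>R M) ** M) $ j $ i * v $ j)) (at t)"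
      by (intro DERIV_sum DERIV_cmult_right matrix_exp_entry_deriv)
    moreover have "transpose M *v (transpose (matrix_exp (t *\<^sub>R M)) *v v)
        = transpose (matrix_exp (t *\<^sub>R M) ** M) *v v"
      by (simp add: matrix_vector_mul_assoc matrix_transpose_mul)
    ultimately show ?thesis
      by (simp add: matrix_vector_mult_def transpose_def)
  qed
  then show ?thesis
    unfolding has_vector_derivative_def has_field_derivative_def
    by (subst has_derivative_componentwise_within)
      (auto simp: Basis_vec_def inner_axis mult_commute_abs)
qed

section \<open>Bounding an output energy by a Lyapunov inequality\<close>

text \<open>\<open>V\<close> decreases and is bounded below by 0, so it has a limit at infinity; the
  integral of \<open>g\<close> is \<open>V 0\<close> minus this limit.\<close>

lemma nn_integral_le_initial_value:
  fixes V f g :: "real \<Rightarrow> real"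
  assumes deriv: "\<And>t. (V has_real_derivative - g t) (at t)"
    and meas: "g \<in> borel_measurable borel"
    and fg: "\<And>t. f t \<le> g t" and f0: "\<And>t. 0 \<le> f t" and V0: "\<And>t. 0 \<le> V t"
  shows "(\<integral>\<^sup>+ t \<in> {0..}. ennreal (f t) \<partial>lborel) \<le> ennreal (V 0)"
proof -
  have g0: "0 \<le> g t" for t using fg[of t] f0[of t] by linarith
  \<comment> \<open>The sign change gives an increasing antiderivative of \<open>g\<close>, whose
    limit at infinity is its supremum.\<close>
  define W where "W t = - V t" for t
  have dW: "(W has_real_derivative g t) (at t)" for t
    unfolding W_def using DERIV_minus[OF deriv[of t]] by simp
  have W_mono: "W s \<le> W t" if "s \<le> t" for s t
    using that dW g0 by (intro DERIV_nonneg_imp_nondecreasing[of s t W]) auto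
  define L where "L = (SUP t. W t)"
  have bdd: "bdd_above (range W)"
    by (rule bdd_aboveI[of _ 0]) (auto simp: W_def V0)
  have lim: "(W \<longlongrightarrow> L) at_top"
  proof (rule increasing_tendsto)
    show "\<forall>\<^sub>F t in at_top. W t \<le> L"
      unfolding L_def by (intro always_eventually allI cSUP_upper bdd) auto
    fix x assume "x < L"
    then obtain s where "x < W s"
      unfolding L_def using less_cSUP_iff[OF _ bdd] by auto
    then show "\<forall>\<^sub>F t in at_top. x < W t"
      using W_mono by (auto simp: eventually_at_top_linorder intro: less_le_trans)
  qed
  have "L \<le> 0"
    unfolding L_def by (rule cSUP_least) (auto simp: W_def V0)
  have "(\<integral>\<^sup>+ t \<in> {0..}. ennreal (f t) \<partial>lborel) \<le> (\<integral>\<^sup>+ t \<in> {0..}. ennreal (g t) \<partial>lborel)"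
    by (intro nn_integral_mono mult_right_mono ennreal_leI fg) auto
  also have "\<dots> = ennreal (L - W 0)"
    using nn_integral_FTC_atLeast[OF meas dW g0 lim] by simp
  also have "\<dots> \<le> ennreal (V 0)"
    using \<open>L \<le> 0\<close> by (intro ennreal_leI) (simp add: W_def)
  finally show ?thesis .
qed

theorem output_energy_le:
  fixes M X :: "real ^ 'k ^ 'k" and E :: "real ^ 'q ^ 'k" and C :: "real ^ 'k ^ 'p"
  assumes sym: "symmetric_matrix X" and psd: "\<And>v. 0 \<le> v \<bullet> (X *v v)"
    and lyap: "\<And>v. 2 * ((transpose M *v v) \<bullet> (X *v v)) + (norm (transpose E *v v))\<^sup>2 \<le> 0"
  defines "T \<equiv> \<lambda>t. C ** matrix_exp (t *\<^sub>R M) ** E"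
  shows "(\<integral>\<^sup>+ t \<in> {0..}. ennreal (trace (transpose (T t) ** T t)) \<partial>lborel)
           \<le> ennreal (trace (C ** X ** transpose C))"
proof -
  \<comment> \<open>\<open>q i t\<close> is the \<open>i\<close>-th row of
    \<open>C ** matrix_exp (t *\<^sub>R M)\<close>, and \<open>V t\<close> is the trace of the
    congruence of \<open>X\<close> by that matrix. By \<open>lyap\<close>, the decay rate
    \<open>g\<close> of \<open>V\<close> dominates the output energy.\<close>
  define q where "q i t = transpose (matrix_exp (t *\<^sub>R M)) *v (C $ i)" for i t
  define V where "V t = (\<Sum>i\<in>UNIV. q i t \<bullet> (X *v q i t))" for t
  define g where "g t = (\<Sum>i\<in>UNIV. - (2 * ((transpose M *v q i t) \<bullet> (X *v q i t))))" for t
  have dq: "(q i has_vector_derivative transpose M *v q i t) (at t)" for i t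
    unfolding q_def by (rule transpose_matrix_exp_deriv)
  have dV: "(V has_real_derivative - g t) (at t)" for t
  proof -
    have "((\<lambda>t. q i t \<bullet> (X *v q i t)) has_real_derivative
        2 * ((transpose M *v q i t) \<bullet> (X *v q i t))) (at t)" for i
    proof -
      have 1: "((\<lambda>t. X *v q i t) has_vector_derivative X *v (transpose M *v q i t)) (at t)"
        by (rule bounded_linear.has_vector_derivative[OF matrix_vector_mul_bounded_linear dq])
      show ?thesis
        using bounded_bilinear.has_vector_derivative[OF bounded_bilinear_inner dq[of i t] 1]
          symmetric_matrix_inner_swap[OF sym, of "q i t" "transpose M *v q i t"]
        by (simp add: has_real_derivative_iff_has_vector_derivative)
    qed
    then have "(V has_real_derivative (\<Sum>i\<in>UNIV. 2 * ((transpose M *v q i t) \<bullet> (X *v q i t)))) (at t)"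
      unfolding V_def by (intro DERIV_sum)
    then show ?thesis by (simp add: g_def sum_negf)
  qed
  have "continuous_on UNIV (q i)" for i
    using dq by (auto simp: continuous_on_eq_continuous_at intro: has_vector_derivative_continuous)
  then have "continuous_on UNIV g"
    unfolding g_def
    by (intro continuous_intros linear_continuous_on_compose[OF _ matrix_vector_mul_linear]) auto
  then have meas: "g \<in> borel_measurable borel"
    by (rule borel_measurable_continuous_onI)
  have T_row: "T t $ i = transpose E *v q i t" for t i
    unfolding T_def q_def by (simp add: matrix_matrix_mult_row)
  have le: "trace (transpose (T t) ** T t) \<le> g t" for t
    unfolding trace_transpose_mult_self T_row g_def
  proof (rule sum_mono)
    show "(norm (transpose E *v q i t))\<^sup>2 \<le> - (2 * ((transpose M *v q i t) \<bullet> (X *v q i t)))" for i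
      using lyap[of "q i t"] by linarith
  qed
  have "(\<integral>\<^sup>+ t \<in> {0..}. ennreal (trace (transpose (T t) ** T t)) \<partial>lborel) \<le> ennreal (V 0)"
    by (rule nn_integral_le_initial_value[OF dV meas le])
      (auto simp: trace_transpose_mult_self V_def intro!: sum_nonneg psd)
  also have "V 0 = trace (C ** X ** transpose C)"
    unfolding V_def q_def matrix_exp_0 trace_congruence by simp
  finally show ?thesis .
qed

section \<open>Definite matrices\<close>

lemma transpose_add:
  fixes M N :: "real ^ 'b ^ 'a"
  shows "transpose (M + N) = transpose M + transpose N"
  by (simp add: vec_eq_iff transpose_def)

lemma transpose_diff:
  fixes M N :: "real ^ 'b ^ 'a"
  shows "transpose (M - N) = transpose M - transpose N"
  by (simp add: vec_eq_iff transpose_def)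

lemma matrix_add_rdistrib:
  fixes M N :: "real ^ 'b ^ 'a"
  shows "(M + N) ** K = M ** K + N ** K"
  by (simp add: vec_eq_iff matrix_matrix_mult_def distrib_right sum.distrib)

lemma pos_def_nonneg:
  assumes "pos_def W"
  shows "0 \<le> x \<bullet> (W *v x)"
  using assms by (cases "x = 0") (auto simp: pos_def_def intro: less_imp_le)

text \<open>Moving from a zero \<open>x\<close> of the form in the direction \<open>S *v x\<close>
  changes it to first order by a multiple of the squared norm of \<open>S *v x\<close>;
  nonnegativity on both sides of \<open>x\<close> makes that norm vanish.\<close>

lemma psd_kernel:
  fixes S :: "real ^ 'n ^ 'n"
  assumes sym: "symmetric_matrix S" and psd: "\<And>x. 0 \<le> x \<bullet> (S *v x)"
    and zero: "x \<bullet> (S *v x) = 0"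
  shows "S *v x = 0"
proof -
  define y where "y = S *v x"
  define n k where "n = y \<bullet> y" and "k = y \<bullet> (S *v y)"
  have "0 \<le> 2 * t * n + t\<^sup>2 * k" for t
  proof -
    have "(x + t *\<^sub>R y) \<bullet> (S *v (x + t *\<^sub>R y)) = 2 * t * n + t\<^sup>2 * k"
      using zero symmetric_matrix_inner_swap[OF sym, of x y]
      by (simp add: matrix_vector_right_distrib matrix_vector_mult_scaleR inner_add_left
          inner_add_right y_def[symmetric] n_def k_def power2_eq_square algebra_simps)
    then show ?thesis by (metis psd)
  qed
  \<comment> \<open>At \<open>t = - u\<close> the quadratic equals
    \<open>- u\<^sup>2 * (k + 2)\<close>; the added 1 keeps the denominator positive when
    \<open>k = 0\<close>.\<close>
  moreover define u where "u = n / (k + 1)"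
  ultimately have "0 \<le> 2 * (- u) * n + (- u)\<^sup>2 * k" by blast
  moreover have "k \<ge> 0" unfolding k_def by (rule psd)
  then have n: "n = u * (k + 1)" by (simp add: u_def)
  ultimately have "u\<^sup>2 * (k + 2) \<le> 0"
    by (simp add: algebra_simps power2_eq_square)
  with \<open>k \<ge> 0\<close> have "u = 0"
    by (simp add: mult_le_0_iff)
  then have "n = 0" by (simp add: n)
  then show ?thesis by (simp add: n_def y_def)
qed

text \<open>Definiteness makes the kernel trivial. The form of the inverse at \<open>x\<close> is
  the form of \<open>P\<close> at \<open>matrix_inv P *v x\<close>, hence positive.\<close>

lemma pos_def_inverse:
  fixes P :: "real ^ 'n ^ 'n"
  assumes "pos_def P"
  shows "P ** matrix_inv P = mat 1" "matrix_inv P ** P = mat 1" "pos_def (matrix_inv P)"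
proof -
  have "inj ((*v) P)"
    unfolding vec.inj_iff_eq_0 using assms by (metis inner_zero_right less_irrefl pos_def_def)
  then have inv: "invertible P"
    by (simp add: invertible_left_inverse matrix_left_invertible_injective)
  then show r: "P ** matrix_inv P = mat 1" and l: "matrix_inv P ** P = mat 1"
    unfolding invertible_def matrix_inv_def by (metis (mono_tags, lifting) someI_ex)+
  have P: "P *v (matrix_inv P *v x) = x" for x
    by (simp add: matrix_vector_mul_assoc r)
  have "transpose P = P" using assms by (simp add: pos_def_def symmetric_matrix_def)
  then have "transpose (matrix_inv P) ** P = mat 1"
    by (metis r matrix_transpose_mul transpose_mat)
  then have "transpose (matrix_inv P) = matrix_inv P"
    by (metis r matrix_mul_assoc matrix_mul_lid matrix_mul_rid)
  moreover have "0 < x \<bullet> (matrix_inv P *v x)" if "x \<noteq> 0" for x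
  proof -
    have "matrix_inv P *v x \<noteq> 0" using that P[of x] by auto
    then have "0 < (matrix_inv P *v x) \<bullet> (P *v (matrix_inv P *v x))"
      using assms by (simp add: pos_def_def)
    then show ?thesis by (simp add: P inner_commute)
  qed
  ultimately show "pos_def (matrix_inv P)"
    by (simp add: pos_def_def symmetric_matrix_def)
qed

text \<open>Schur complements: subtracting the rank-one matrix that clears a row with nonzero diagonal
  entry keeps the matrix positive semidefinite, so it is a sum of such rank-one matrices.\<close>

lemma trace_mult_nonpos_psd:
  fixes N S :: "real ^ 'n ^ 'n"
  assumes N: "\<And>x. x \<bullet> (N *v x) \<le> 0"
    and "symmetric_matrix S" and "\<And>x. 0 \<le> x \<bullet> (S *v x)"
  shows "trace (N ** S) \<le> 0"
  using assms(2,3)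
proof (induction "card {i. S $ i $ i \<noteq> 0}" arbitrary: S rule: less_induct)
  case less
  note sym = less.prems(1) and psd = less.prems(2)
  have axis: "axis i 1 \<bullet> (S *v axis i 1) = S $ i $ i" for i
    by (simp add: inner_axis' matrix_vector_mult_basis column_def)
  have S_sym: "S $ i $ j = S $ j $ i" for i j
  proof -
    have "transpose S $ j $ i = S $ j $ i" using sym by (simp add: symmetric_matrix_def)
    then show ?thesis by (simp add: transpose_def)
  qed
  \<comment> \<open>If the diagonal entry vanishes, \<open>axis i 1\<close> is a zero of the form,
    and \<open>psd_kernel\<close> clears the whole column.\<close>
  have zero_row: "S $ j $ i = 0" if "S $ i $ i = 0" for i j
  proof -
    have "S *v axis i 1 = 0"
      using psd_kernel[OF sym psd, of "axis i 1"] that by (simp add: axis)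
    then have "column i S $ j = 0" by (simp add: matrix_vector_mult_basis)
    then show ?thesis by (simp add: column_def)
  qed
  show ?case
  proof (cases "\<forall>i. S $ i $ i = 0")
    case True
    then have "S = 0" using zero_row by (simp add: vec_eq_iff)
    then show ?thesis by (simp add: trace_def)
  next
    case False
    then obtain i where i: "S $ i $ i \<noteq> 0" by blast
    define d s where "d = S $ i $ i" and "s = S $ i"
    define R :: "real ^ 'n ^ 'n" where "R = (\<chi> j k. s $ j * s $ k)"
    define S' where "S' = S - (1 / d) *\<^sub>R R"
    have d: "d > 0" using psd[of "axis i 1"] i by (simp add: d_def axis)
    have R_mult: "R *v x = (s \<bullet> x) *\<^sub>R s" for x
      by (simp add: R_def vec_eq_iff matrix_vector_mult_def inner_vec_def sum_distrib_left
          sum_distrib_right mult_ac)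
    have S'_form: "x \<bullet> (S' *v x) = x \<bullet> (S *v x) - (s \<bullet> x)\<^sup>2 / d" for x
      by (simp add: S'_def matrix_vector_mult_diff_rdistrib scaleR_matrix_vector_assoc[symmetric]
          R_mult inner_diff_right power2_eq_square inner_commute)
    have sym': "symmetric_matrix S'"
      using S_sym by (simp add: symmetric_matrix_def vec_eq_iff transpose_def S'_def R_def mult.commute)
    have S_axis: "S *v axis i 1 = s"
      using S_sym by (simp add: matrix_vector_mult_basis column_def s_def vec_eq_iff)
    have psd': "0 \<le> x \<bullet> (S' *v x)" for x
    proof -
      \<comment> \<open>This \<open>c\<close> minimises the form of \<open>S\<close> along the line
        \<open>x - c *\<^sub>R axis i 1\<close>; the minimum is the form of \<open>S'\<close> at
        \<open>x\<close>.\<close>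
      define c where "c = (s \<bullet> x) / d"
      have c: "c * d = s \<bullet> x" using d by (simp add: c_def)
      have "0 \<le> (x - c *\<^sub>R axis i 1) \<bullet> (S *v (x - c *\<^sub>R axis i 1))" by (rule psd)
      also have "\<dots> = x \<bullet> (S *v x) - 2 * c * (s \<bullet> x) + c * c * d"
        using symmetric_matrix_inner_swap[OF sym, of "axis i 1" x] axis[of i]
        by (simp add: matrix_vector_mult_diff_distrib matrix_vector_mult_scaleR S_axis
            inner_diff_left inner_diff_right d_def[symmetric] inner_commute algebra_simps)
      also have "c * c * d = c * (s \<bullet> x)" by (simp add: c mult.assoc)
      also have "x \<bullet> (S *v x) - 2 * c * (s \<bullet> x) + c * (s \<bullet> x) = x \<bullet> (S' *v x)"
        by (simp add: S'_form c_def power2_eq_square)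
      finally show ?thesis .
    qed
    \<comment> \<open>The index \<open>i\<close> leaves the set, and none enters: where the diagonal
      of \<open>S\<close> vanishes, so does \<open>s\<close>.\<close>
    have "{j. S' $ j $ j \<noteq> 0} \<subset> {j. S $ j $ j \<noteq> 0}"
    proof
      show "{j. S' $ j $ j \<noteq> 0} \<subseteq> {j. S $ j $ j \<noteq> 0}"
        using zero_row by (auto simp: S'_def R_def s_def)
      show "{j. S' $ j $ j \<noteq> 0} \<noteq> {j. S $ j $ j \<noteq> 0}"
      proof -
        have "S' $ i $ i = 0" using i by (simp add: S'_def R_def s_def d_def)
        then show ?thesis using i by blast
      qed
    qed
    then have "card {j. S' $ j $ j \<noteq> 0} < card {j. S $ j $ j \<noteq> 0}"
      by (intro psubset_card_mono) auto
    then have "trace (N ** S') \<le> 0" by (rule less.hyps[OF _ sym' psd'])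
    moreover have "trace (N ** R) = s \<bullet> (N *v s)"
      by (simp add: trace_def matrix_matrix_mult_def R_def inner_vec_def matrix_vector_mult_def
          sum_distrib_left mult_ac)
    moreover have "N ** S = N ** S' + (1 / d) *\<^sub>R (N ** R)"
    proof -
      have "N ** S = N ** (S' + (1 / d) *\<^sub>R R)" by (simp add: S'_def)
      then show ?thesis by (simp add: matrix_add_ldistrib matrix_scalar_ac scalar_matrix_assoc)
    qed
    moreover have "trace ((1 / d) *\<^sub>R (N ** R)) = (1 / d) * trace (N ** R)"
      by (simp add: trace_def sum_distrib_left sum_divide_distrib)
    ultimately have "trace (N ** S) = trace (N ** S') + s \<bullet> (N *v s) / d"
      by (simp add: trace_add)
    also have "\<dots> \<le> 0"
      using \<open>trace (N ** S') \<le> 0\<close> N[of s] d by (simp add: add_nonpos_nonpos divide_nonpos_pos)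
    finally show ?thesis .
  qed
qed

section \<open>Lyapunov equations and Hurwitz matrices\<close>

text \<open>Minimising the quotient of the two quadratic forms gives a real \<open>c\<close> for which
  \<open>S - c W\<close> is positive semidefinite with a kernel vector \<open>x\<close>. Evaluating both Lyapunov forms
  at \<open>x\<close> forces \<open>c \<ge> 0\<close>.\<close>

lemma lyapunov_psd:
  fixes M W S :: "real ^ 'n ^ 'n"
  assumes W: "pos_def W" and neg: "\<And>x. x \<noteq> 0 \<Longrightarrow> (transpose M *v x) \<bullet> (W *v x) < 0"
    and S: "symmetric_matrix S" and le: "\<And>x. (transpose M *v x) \<bullet> (S *v x) \<le> 0"
  shows "0 \<le> y \<bullet> (S *v y)"
proof -
  define f where "f x = (x \<bullet> (S *v x)) / (x \<bullet> (W *v x))" for x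
  have Wpos: "0 < x \<bullet> (W *v x)" if "x \<noteq> 0" for x using W that by (simp add: pos_def_def)
  have "continuous_on (sphere 0 1) f"
    unfolding f_def
  proof (intro continuous_intros ballI linear_continuous_on_compose[OF _ matrix_vector_mul_linear])
    show "x \<bullet> (W *v x) \<noteq> 0" if "x \<in> sphere 0 1" for x
    proof -
      have "x \<noteq> 0" using that by auto
      then show ?thesis using Wpos[of x] by simp
    qed
  qed
  moreover have "sphere (0 :: real ^ 'n) 1 \<noteq> {}"
    using norm_axis_1 by (auto simp: dist_norm)
  ultimately obtain x where x: "x \<in> sphere 0 1" and min: "\<And>z. z \<in> sphere 0 1 \<Longrightarrow> f x \<le> f z"
    using continuous_attains_inf[of "sphere 0 1" f] by auto
  define c where "c = f x"
  have "x \<noteq> 0" using x by auto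
  define D where "D = S - c *\<^sub>R W"
  have D_mult: "D *v z = S *v z - c *\<^sub>R (W *v z)" for z
    by (simp add: D_def matrix_vector_mult_diff_rdistrib scaleR_matrix_vector_assoc)
  have D_form: "z \<bullet> (D *v z) = z \<bullet> (S *v z) - c * (z \<bullet> (W *v z))" for z
    by (simp add: D_mult inner_diff_right)
  have D_psd: "0 \<le> z \<bullet> (D *v z)" for z
  \<comment> \<open>The minimality of \<open>c\<close> is known on the unit sphere and extends by
    homogeneity.\<close>
  proof (cases "z = 0")
    case False
    define u where "u = (1 / norm z) *\<^sub>R z"
    have "u \<noteq> 0" "u \<in> sphere 0 1" using False by (simp_all add: u_def)
    then have "c * (u \<bullet> (W *v u)) \<le> u \<bullet> (S *v u)"
      using min[of u] Wpos[of u] by (simp add: c_def f_def[of u] pos_le_divide_eq)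
    then have "0 \<le> u \<bullet> (D *v u)" by (simp add: D_form)
    also have "u \<bullet> (D *v u) = (z \<bullet> (D *v z)) / (norm z)\<^sup>2"
      by (simp add: u_def matrix_vector_mult_scaleR power2_eq_square)
    finally show ?thesis using False by (simp add: zero_le_divide_iff)
  qed simp
  have "x \<bullet> (D *v x) = 0"
    using Wpos[OF \<open>x \<noteq> 0\<close>] by (simp add: D_form c_def f_def)
  moreover have "symmetric_matrix D"
    using S W by (simp add: symmetric_matrix_def pos_def_def D_def transpose_diff transpose_scalar)
  ultimately have "D *v x = 0" using psd_kernel D_psd by blast
  then have "S *v x = c *\<^sub>R (W *v x)" by (simp add: D_mult)
  then have "c * ((transpose M *v x) \<bullet> (W *v x)) \<le> 0" using le[of x] by simp
  then have "0 \<le> c" using neg[OF \<open>x \<noteq> 0\<close>] by (simp add: mult_le_0_iff)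
  moreover have "0 \<le> y \<bullet> (W *v y)" by (rule pos_def_nonneg[OF W])
  ultimately have "0 \<le> c * (y \<bullet> (W *v y))" by simp
  then show ?thesis using D_psd[of y] by (simp add: D_form)
qed

text \<open>For symmetric \<open>S\<close>, the products \<open>M ** S\<close> and
  \<open>S ** transpose M\<close> contribute equally to the quadratic form.\<close>

lemma lyapunov_equation_form:
  fixes M S K :: "real ^ 'n ^ 'n"
  assumes "symmetric_matrix S" and "M ** S + S ** transpose M + K = 0"
  shows "2 * ((transpose M *v x) \<bullet> (S *v x)) + x \<bullet> (K *v x) = 0"
proof -
  have "x \<bullet> ((M ** S + S ** transpose M + K) *v x) = 0" using assms(2) by simp
  moreover have "x \<bullet> (M *v (S *v x)) = (transpose M *v x) \<bullet> (S *v x)"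
    using inner_matrix_vector_mult_left[of "transpose M" x "S *v x"] by simp
  moreover have "x \<bullet> (S *v (transpose M *v x)) = (transpose M *v x) \<bullet> (S *v x)"
    by (rule symmetric_matrix_inner_swap[OF assms(1)])
  ultimately show ?thesis
    by (simp add: matrix_vector_mult_add_rdistrib matrix_vector_mul_assoc[symmetric] inner_add_right)
qed

text \<open>The summand \<open>S - S\<^sup>T\<close> of \<open>L\<close> makes the Lyapunov operator injective on all matrices,
  not just on the symmetric ones.\<close>

lemma lyapunov_equation_solvable:
  fixes M W K :: "real ^ 'n ^ 'n"
  assumes W: "pos_def W" and neg: "\<And>x. x \<noteq> 0 \<Longrightarrow> (transpose M *v x) \<bullet> (W *v x) < 0"
    and K: "symmetric_matrix K" "\<And>x. 0 \<le> x \<bullet> (K *v x)"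
  obtains S where "symmetric_matrix S" "\<And>x. 0 \<le> x \<bullet> (S *v x)"
    "M ** S + S ** transpose M + K = 0"
proof -
  define H where "H S = S + transpose S" for S :: "real ^ 'n ^ 'n"
  define L where "L S = M ** H S + H S ** transpose M + (S - transpose S)" for S :: "real ^ 'n ^ 'n"
  have H_sym: "symmetric_matrix (H S)" for S
    by (simp add: symmetric_matrix_def H_def transpose_add add.commute)
  have psd: "0 \<le> x \<bullet> (S *v x)"
    if "symmetric_matrix S" "M ** S + S ** transpose M + K' = 0" "\<And>x. 0 \<le> x \<bullet> (K' *v x)" for S K' x
  proof (rule lyapunov_psd[OF W neg that(1)])
    show "(transpose M *v x) \<bullet> (S *v x) \<le> 0" for x
      using lyapunov_equation_form[OF that(1,2), of x] that(3)[of x] by linarith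
  qed
  \<comment> \<open>Transposing \<open>L S\<close> only flips the sign of the summand
    \<open>S - transpose S\<close>, so this summand vanishes when \<open>L S\<close> is
    symmetric.\<close>
  have L_symD: "transpose S = S" "M ** H S + H S ** transpose M = L S"
    if "symmetric_matrix (L S)" for S
  proof -
    have "transpose (H S) = H S" using H_sym[of S] by (simp add: symmetric_matrix_def)
    then have "transpose (L S) = M ** H S + H S ** transpose M - (S - transpose S)"
      by (simp add: L_def transpose_add transpose_diff matrix_transpose_mul add.commute)
    moreover have "transpose (L S) = L S"
      using that by (simp add: symmetric_matrix_def)
    ultimately have "(S - transpose S) = - (S - transpose S)"
      unfolding L_def by (metis add_left_cancel diff_conv_add_uminus)
    then have "S - transpose S = 0" by (simp add: vec_eq_iff)
    then show "transpose S = S" "M ** H S + H S ** transpose M = L S"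
      by (simp_all add: L_def)
  qed
  have lin: "linear L"
  proof
    show "L (S + T) = L S + L T" for S T
      by (simp add: L_def H_def transpose_add matrix_add_ldistrib matrix_add_rdistrib algebra_simps)
    show "L (r *\<^sub>R S) = r *\<^sub>R L S" for r S
      by (simp add: L_def H_def transpose_scalar matrix_scalar_ac scalar_matrix_assoc[symmetric]
          scaleR_add_right[symmetric] scaleR_diff_right[symmetric])
  qed
  \<comment> \<open>Both \<open>H S\<close> and \<open>- H S\<close> solve the homogeneous equation,
    so both are positive semidefinite and the form of \<open>H S\<close> is zero.\<close>
  have "S = 0" if "L S = 0" for S
  proof -
    have "symmetric_matrix (L S)" by (simp add: that symmetric_matrix_def transpose_def vec_eq_iff)
    note S = L_symD[OF this]
    have eq: "M ** H S + H S ** transpose M + 0 = 0" using S(2) that by simp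
    have "H (- S) = - H S" by (simp add: H_def vec_eq_iff transpose_def)
    moreover have "M ** H (- S) + H (- S) ** transpose M + 0 = 0"
      using eq linear_neg[OF lin, of S] that L_symD(2)[of "- S"]
      by (simp add: symmetric_matrix_def transpose_def vec_eq_iff)
    ultimately have "0 \<le> x \<bullet> ((- H S) *v x)" for x
      using psd[OF H_sym[of "- S"], of 0 x] by simp
    moreover have pos: "0 \<le> x \<bullet> (H S *v x)" for x
      using psd[OF H_sym eq] by simp
    ultimately have "x \<bullet> (H S *v x) = 0" for x
      by (simp add: matrix_vector_mult_uminus_left antisym)
    then have "H S *v x = 0" for x
      using psd_kernel[OF H_sym pos] by blast
    then have "H S = 0" by (simp add: matrix_eq)
    then have "S + S = 0" by (simp add: H_def S(1))
    then show ?thesis by (simp add: vec_eq_iff)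
  qed
  then have "inj L" using linear_injective_0[OF lin] by blast
  then have "surj L" by (rule linear_injective_imp_surjective[OF lin _ refl])
  \<comment> \<open>As \<open>K\<close> is symmetric, the extra summand of \<open>L S\<close>
    vanishes, and \<open>H S\<close> is the required solution.\<close>
  then obtain S where S: "L S = - K" by (metis surjD)
  have "symmetric_matrix (L S)"
    using K(1) unfolding S by (simp add: symmetric_matrix_def transpose_def vec_eq_iff)
  then have eq: "M ** H S + H S ** transpose M + K = 0"
    using L_symD(2)[of S] S by simp
  show thesis
    using that[OF H_sym psd[OF H_sym eq K(2)] eq] .
qed

text \<open>The hypotheses on \<open>a\<close> and \<open>b\<close> are the real and imaginary parts
  of the equation for an eigenvector \<open>a + i b\<close> with eigenvalue \<sigma> + i \<omega>.
  This keeps the Lyapunov arguments over the reals.\<close>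

lemma hurwitzI_real:
  fixes M :: "real ^ 'n ^ 'n"
  assumes "\<And>a b \<sigma> \<omega>. a \<noteq> 0 \<or> b \<noteq> 0 \<Longrightarrow> M *v a = \<sigma> *\<^sub>R a - \<omega> *\<^sub>R b \<Longrightarrow> M *v b = \<omega> *\<^sub>R a + \<sigma> *\<^sub>R b \<Longrightarrow> \<sigma> < 0"
  shows "hurwitz M"
  unfolding hurwitz_def eigenvalue_def
proof (intro allI impI, elim exE conjE)
  fix \<mu> v assume v: "v \<noteq> 0" "map_matrix complex_of_real M *v v = \<mu> *s v"
  define a b where "a = (\<chi> i. Re (v $ i))" and "b = (\<chi> i. Im (v $ i))"
  have "a \<noteq> 0 \<or> b \<noteq> 0"
    using v(1) by (auto simp: a_def b_def vec_eq_iff complex_eq_iff)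
  moreover have eq: "(\<Sum>j\<in>UNIV. complex_of_real (M $ i $ j) * v $ j) = \<mu> * v $ i" for i
    using arg_cong[OF v(2), of "\<lambda>w. w $ i"]
    by (simp add: matrix_vector_mult_def map_matrix_def)
  have "M *v a = Re \<mu> *\<^sub>R a - Im \<mu> *\<^sub>R b"
    using arg_cong[OF eq, of Re] by (simp add: vec_eq_iff matrix_vector_mult_def a_def b_def)
  moreover have "M *v b = Im \<mu> *\<^sub>R a + Re \<mu> *\<^sub>R b"
    using arg_cong[OF eq, of Im]
    by (simp add: vec_eq_iff matrix_vector_mult_def a_def b_def add.commute)
  ultimately show "Re \<mu> < 0" by (rule assms)
qed

text \<open>Adding the forms at \<open>a\<close> and \<open>b\<close> cancels the \<omega> terms by
  symmetry of \<open>W\<close> and leaves \<sigma> times a nonnegative number.\<close>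

lemma lyapunov_real_part_neg:
  fixes M W :: "real ^ 'n ^ 'n"
  assumes W: "pos_def W" and neg: "\<And>x. x \<noteq> 0 \<Longrightarrow> x \<bullet> (W *v (M *v x)) < 0"
    and ab: "a \<noteq> 0 \<or> b \<noteq> 0"
    and Ma: "M *v a = \<sigma> *\<^sub>R a - \<omega> *\<^sub>R b" and Mb: "M *v b = \<omega> *\<^sub>R a + \<sigma> *\<^sub>R b"
  shows "\<sigma> < 0"
proof -
  have sym: "a \<bullet> (W *v b) = b \<bullet> (W *v a)"
    using W symmetric_matrix_inner_swap by (auto simp: pos_def_def)
  have "a \<bullet> (W *v (M *v a)) + b \<bullet> (W *v (M *v b)) = \<sigma> * (a \<bullet> (W *v a) + b \<bullet> (W *v b))"
    unfolding Ma Mb using sym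
    by (simp add: matrix_vector_mult_diff_distrib matrix_vector_right_distrib
        matrix_vector_mult_scaleR inner_diff_right inner_add_right algebra_simps)
  moreover have "a \<bullet> (W *v (M *v a)) + b \<bullet> (W *v (M *v b)) < 0"
    using ab neg[of a] neg[of b] by (cases "a = 0"; cases "b = 0") auto
  moreover have "0 \<le> a \<bullet> (W *v a) + b \<bullet> (W *v b)"
    using pos_def_nonneg[OF W] by (simp add: add_nonneg_nonneg)
  ultimately show ?thesis by (metis mult_nonneg_nonneg not_less)
qed

section \<open>Block matrices\<close>

definition vec_fst :: "real ^ ('a::finite + 'b::finite) \<Rightarrow> real ^ 'a" where
  "vec_fst v = (\<chi> i. v $ Inl i)"

definition vec_snd :: "real ^ ('a::finite + 'b::finite) \<Rightarrow> real ^ 'b" where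
  "vec_snd v = (\<chi> i. v $ Inr i)"

lemma sum_UNIV_sum_type:
  fixes f :: "'a::finite + 'b::finite \<Rightarrow> real"
  shows "sum f UNIV = (\<Sum>i\<in>UNIV. f (Inl i)) + (\<Sum>i\<in>UNIV. f (Inr i))"
  using sum.Plus[of "UNIV :: 'a set" "UNIV :: 'b set" f] by simp

lemma vec_fst_snd_eq_iff: "u = v \<longleftrightarrow> vec_fst u = vec_fst v \<and> vec_snd u = vec_snd v"
  by (auto simp: vec_eq_iff vec_fst_def vec_snd_def split_sum_all)

lemma vec_fst_simps [simp]:
  "vec_fst 0 = 0" "vec_fst (u + v) = vec_fst u + vec_fst v" "vec_fst (u - v) = vec_fst u - vec_fst v"
  "vec_fst (c *\<^sub>R v) = c *\<^sub>R vec_fst v"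
  by (simp_all add: vec_fst_def vec_eq_iff)

lemma vec_snd_simps [simp]:
  "vec_snd 0 = 0" "vec_snd (u + v) = vec_snd u + vec_snd v" "vec_snd (u - v) = vec_snd u - vec_snd v"
  "vec_snd (c *\<^sub>R v) = c *\<^sub>R vec_snd v"
  by (simp_all add: vec_snd_def vec_eq_iff)

lemma inner_vec_fst_snd: "u \<bullet> v = vec_fst u \<bullet> vec_fst v + vec_snd u \<bullet> vec_snd v"
  by (simp add: inner_vec_def sum_UNIV_sum_type vec_fst_def vec_snd_def)

lemma hblock_mult_vec: "hblock X Y *v v = X *v vec_fst v + Y *v vec_snd v"
  by (simp add: vec_eq_iff hblock_def matrix_vector_mult_def sum_UNIV_sum_type vec_fst_def vec_snd_def)

lemma vec_fst_vblock_mult [simp]: "vec_fst (vblock X Y *v v) = X *v v"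
  by (simp add: vec_eq_iff vblock_def matrix_vector_mult_def vec_fst_def)

lemma vec_snd_vblock_mult [simp]: "vec_snd (vblock X Y *v v) = Y *v v"
  by (simp add: vec_eq_iff vblock_def matrix_vector_mult_def vec_snd_def)

lemma transpose_vblock: "transpose (vblock X Y) = hblock (transpose X) (transpose Y)"
  by (simp add: vec_eq_iff transpose_def hblock_def vblock_def split: sum.split)

lemma transpose_hblock: "transpose (hblock X Y) = vblock (transpose X) (transpose Y)"
  by (simp add: vec_eq_iff transpose_def hblock_def vblock_def split: sum.split)

lemma vec_fst_hblock_row [simp]: "vec_fst (hblock X Y $ i) = X $ i"
  by (simp add: vec_eq_iff vec_fst_def hblock_def)

lemma vec_snd_hblock_row [simp]: "vec_snd (hblock X Y $ i) = Y $ i"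
  by (simp add: vec_eq_iff vec_snd_def hblock_def)

section \<open>The closed loop\<close>

text \<open>The gain \<open>F\<close> turns the Riccati inequality into a Lyapunov inequality for
  \<open>A + B ** F\<close>. With \<open>y\<close> and \<open>z\<close> as below, the feedback
  contributes \<open>- 2 * (y \<bullet> z)\<close> through the dynamics and
  \<open>y \<bullet> z\<close> through the output, together the quadratic Riccati term.\<close>

lemma control_riccati_form:
  fixes A P :: "real ^ 'n ^ 'n" and B :: "real ^ 'm ^ 'n" and C2 :: "real ^ 'n ^ 'p" and D2 :: "real ^ 'm ^ 'p"
  assumes orth: "transpose D2 ** C2 = 0" and R: "pos_def (transpose D2 ** D2)"
    and P: "symmetric_matrix P"
    and ric: "neg_def (transpose A ** P + P ** A
           - P ** B ** matrix_inv (transpose D2 ** D2) ** transpose B ** P + transpose C2 ** C2)"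
    and F: "F = - (matrix_inv (transpose D2 ** D2) ** transpose B ** P)"
    and x: "x \<noteq> 0"
  shows "2 * (x \<bullet> (P *v ((A + B ** F) *v x))) + (norm ((C2 + D2 ** F) *v x))\<^sup>2 < 0"
proof -
  define y where "y = transpose B *v (P *v x)"
  define z where "z = matrix_inv (transpose D2 ** D2) *v y"
  have P_swap: "u \<bullet> (P *v v) = (P *v u) \<bullet> v" for u v
    using symmetric_matrix_inner_swap[OF P, of u v] by (simp add: inner_commute)
  have B_swap: "u \<bullet> (B *v v) = (transpose B *v u) \<bullet> v" for u v
    using inner_matrix_vector_mult_left[of "transpose B" u v] by simp
  have Fx: "F *v x = - z"
    by (simp add: F z_def y_def matrix_vector_mult_uminus_left matrix_vector_mul_assoc matrix_mul_assoc)
  have Rz: "transpose D2 *v (D2 *v z) = y"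
    by (simp add: z_def matrix_vector_mul_assoc matrix_mul_assoc pos_def_inverse(1)[OF R])
  have "x \<bullet> ((transpose A ** P + P ** A
           - P ** B ** matrix_inv (transpose D2 ** D2) ** transpose B ** P + transpose C2 ** C2) *v x) < 0"
    using ric x by (simp add: neg_def_def)
  then have "x \<bullet> (transpose A *v (P *v x)) + x \<bullet> (P *v (A *v x)) - x \<bullet> (P *v (B *v z))
      + x \<bullet> (transpose C2 *v (C2 *v x)) < 0"
    by (simp add: matrix_vector_mult_add_rdistrib matrix_vector_mult_diff_rdistrib
        matrix_vector_mul_assoc[symmetric] inner_add_right inner_diff_right z_def y_def)
  moreover have "x \<bullet> (transpose A *v (P *v x)) = x \<bullet> (P *v (A *v x))"
    using inner_matrix_vector_mult_left[of A x "P *v x"] symmetric_matrix_inner_swap[OF P, of "A *v x" x]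
    by simp
  moreover have "x \<bullet> (P *v (B *v z)) = y \<bullet> z"
    by (simp add: P_swap B_swap y_def)
  moreover have "x \<bullet> (transpose C2 *v (C2 *v x)) = (norm (C2 *v x))\<^sup>2"
    by (simp add: inner_matrix_vector_mult_left[symmetric] power2_norm_eq_inner)
  moreover have "x \<bullet> (P *v ((A + B ** F) *v x)) = x \<bullet> (P *v (A *v x)) - y \<bullet> z"
    by (simp add: matrix_vector_mult_add_rdistrib matrix_vector_mul_assoc[symmetric] Fx P_swap
        B_swap y_def inner_add_right inner_diff_right matrix_vector_mult_diff_distrib
        vec.neg[symmetric])
  moreover have "(norm ((C2 + D2 ** F) *v x))\<^sup>2 = (norm (C2 *v x))\<^sup>2 + y \<bullet> z"
  \<comment> \<open>Orthogonality of \<open>D2\<close> and \<open>C2\<close> removes the cross term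
    of the squared norm.\<close>
  proof -
    have "(D2 *v z) \<bullet> (C2 *v x) = z \<bullet> ((transpose D2 ** C2) *v x)"
      by (simp add: inner_matrix_vector_mult_left matrix_vector_mul_assoc)
    then have "(D2 *v z) \<bullet> (C2 *v x) = 0" by (simp add: orth)
    moreover have "(D2 *v z) \<bullet> (D2 *v z) = y \<bullet> z"
      by (simp add: inner_matrix_vector_mult_left Rz inner_commute)
    moreover have "(C2 + D2 ** F) *v x = C2 *v x - D2 *v z"
      by (simp add: matrix_vector_mult_add_rdistrib matrix_vector_mul_assoc[symmetric] Fx vec.neg)
    ultimately show ?thesis
      by (simp add: power2_norm_eq_inner inner_diff_left inner_diff_right inner_commute)
  qed
  ultimately show ?thesis by linarith
qed

text \<open>The dual Riccati inequality as a quadratic form, needed both for the decay of the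
  estimation error and for the cost bound.\<close>

lemma filter_riccati_form:
  fixes A Q :: "real ^ 'n ^ 'n" and C1 :: "real ^ 'n ^ 'r" and E :: "real ^ 'q ^ 'n"
  assumes Q: "symmetric_matrix Q"
    and ric: "neg_def (A ** Q + Q ** transpose A - Q ** transpose C1 ** C1 ** Q + E ** transpose E)"
    and x: "x \<noteq> 0"
  shows "2 * ((transpose A *v x) \<bullet> (Q *v x)) + (norm (transpose E *v x))\<^sup>2 < (norm (C1 *v (Q *v x)))\<^sup>2"
proof -
  have "x \<bullet> ((A ** Q + Q ** transpose A - Q ** transpose C1 ** C1 ** Q + E ** transpose E) *v x) < 0"
    using ric x by (simp add: neg_def_def)
  then have "x \<bullet> (A *v (Q *v x)) + x \<bullet> (Q *v (transpose A *v x))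
      - x \<bullet> (Q *v (transpose C1 *v (C1 *v (Q *v x)))) + x \<bullet> (E *v (transpose E *v x)) < 0"
    by (simp add: matrix_vector_mult_add_rdistrib matrix_vector_mult_diff_rdistrib
        matrix_vector_mul_assoc[symmetric] inner_add_right inner_diff_right)
  moreover have "x \<bullet> (A *v (Q *v x)) = (transpose A *v x) \<bullet> (Q *v x)"
    using inner_matrix_vector_mult_left[of "transpose A" x "Q *v x"] by simp
  moreover have "x \<bullet> (Q *v (transpose A *v x)) = (transpose A *v x) \<bullet> (Q *v x)"
    by (rule symmetric_matrix_inner_swap[OF Q])
  moreover have "x \<bullet> (Q *v (transpose C1 *v (C1 *v (Q *v x)))) = (norm (C1 *v (Q *v x)))\<^sup>2"
    using symmetric_matrix_inner_swap[OF Q, of x "transpose C1 *v (C1 *v (Q *v x))"]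
      inner_matrix_vector_mult_left[of C1 "Q *v x" "C1 *v (Q *v x)"]
    by (simp add: power2_norm_eq_inner inner_commute)
  moreover have "x \<bullet> (E *v (transpose E *v x)) = (norm (transpose E *v x))\<^sup>2"
    using inner_matrix_vector_mult_left[of "transpose E" x "transpose E *v x"]
    by (simp add: power2_norm_eq_inner)
  ultimately show ?thesis by linarith
qed

text \<open>The error \<open>e\<close> evolves by \<open>A - G ** C1\<close> alone. An eigenvector
  with nonzero error yields one of \<open>A - G ** C1\<close>; if its error is zero, its
  \<open>w\<close> part is an eigenvector of \<open>A + B ** F\<close>.\<close>

lemma separation_principle:
  fixes A W\<^sub>1 W\<^sub>2 :: "real ^ 'n ^ 'n"
  assumes W1: "pos_def W\<^sub>1" "\<And>x. x \<noteq> 0 \<Longrightarrow> x \<bullet> (W\<^sub>1 *v ((A - G ** C1) *v x)) < 0"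
    and W2: "pos_def W\<^sub>2" "\<And>x. x \<noteq> 0 \<Longrightarrow> x \<bullet> (W\<^sub>2 *v ((A + B ** F) *v x)) < 0"
  shows "internally_stabilizes A B C1 F G"
  unfolding internally_stabilizes_def
proof (rule hurwitzI_real)
  define M where "M = closed_loop_A A B C1 F G"
  define e where "e v = vec_fst v - vec_snd v" for v :: "real ^ ('n + 'n)"
  have fst_M: "vec_fst (M *v v) = A *v vec_fst v + (B ** F) *v vec_snd v" for v
    by (simp add: M_def closed_loop_A_def hblock_mult_vec)
  have snd_M: "vec_snd (M *v v) = (G ** C1) *v e v + (A + B ** F) *v vec_snd v" for v
    by (simp add: M_def closed_loop_A_def hblock_mult_vec e_def matrix_vector_mult_add_rdistrib
        matrix_vector_mult_diff_rdistrib matrix_vector_mult_diff_distrib)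
  have e_M: "e (M *v v) = (A - G ** C1) *v e v" for v
    unfolding e_def[of "M *v v"] fst_M snd_M
    by (simp add: e_def matrix_vector_mult_add_rdistrib matrix_vector_mult_diff_rdistrib
        matrix_vector_mult_diff_distrib)
  fix a b \<sigma> \<omega>
  assume ab: "a \<noteq> 0 \<or> b \<noteq> 0"
    and "closed_loop_A A B C1 F G *v a = \<sigma> *\<^sub>R a - \<omega> *\<^sub>R b"
    and "closed_loop_A A B C1 F G *v b = \<omega> *\<^sub>R a + \<sigma> *\<^sub>R b"
  then have Ma: "M *v a = \<sigma> *\<^sub>R a - \<omega> *\<^sub>R b" and Mb: "M *v b = \<omega> *\<^sub>R a + \<sigma> *\<^sub>R b"
    by (simp_all add: M_def)
  show "\<sigma> < 0"
  proof (cases "e a \<noteq> 0 \<or> e b \<noteq> 0")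
    case True
    show ?thesis
    proof (rule lyapunov_real_part_neg[OF W1 True])
      show "(A - G ** C1) *v e a = \<sigma> *\<^sub>R e a - \<omega> *\<^sub>R e b"
        unfolding e_M[symmetric] Ma by (simp add: e_def algebra_simps)
      show "(A - G ** C1) *v e b = \<omega> *\<^sub>R e a + \<sigma> *\<^sub>R e b"
        unfolding e_M[symmetric] Mb by (simp add: e_def algebra_simps)
    qed
  next
    case False
    then have snd_ab: "vec_snd a \<noteq> 0 \<or> vec_snd b \<noteq> 0"
      using ab by (auto simp: e_def vec_fst_snd_eq_iff)
    show ?thesis
    proof (rule lyapunov_real_part_neg[OF W2 snd_ab])
      show "(A + B ** F) *v vec_snd a = \<sigma> *\<^sub>R vec_snd a - \<omega> *\<^sub>R vec_snd b"
        using snd_M[of a] False by (simp add: Ma)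
      show "(A + B ** F) *v vec_snd b = \<omega> *\<^sub>R vec_snd a + \<sigma> *\<^sub>R vec_snd b"
        using snd_M[of b] False by (simp add: Mb)
    qed
  qed
qed

text \<open>\<open>X\<close> satisfies the Lyapunov inequality of \<open>output_energy_le\<close>:
  the error block relies on the Riccati inequality, the \<open>w\<close> block on the equation for
  \<open>S\<close>, and the mixed terms cancel because \<open>transpose G = C1 ** Q\<close>.\<close>

lemma H2_cost_le:
  fixes A Q S :: "real ^ 'n ^ 'n" and E :: "real ^ 'q ^ 'n" and C1 :: "real ^ 'n ^ 'r"
  assumes orth: "D1 ** transpose E = 0" and D1: "D1 ** transpose D1 = mat 1"
    and Q: "pos_def Q"
    and ric: "neg_def (A ** Q + Q ** transpose A - Q ** transpose C1 ** C1 ** Q + E ** transpose E)"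
    and G: "G = Q ** transpose C1"
    and S: "symmetric_matrix S" "\<And>x. 0 \<le> x \<bullet> (S *v x)"
    and lyap: "(A + B ** F) ** S + S ** transpose (A + B ** F) + G ** transpose G = 0"
  shows "H2_cost A B E C1 D1 C2 D2 F G
    \<le> ennreal (trace (C2 ** Q ** transpose C2)
        + trace ((C2 + D2 ** F) ** S ** transpose (C2 + D2 ** F)))"
proof -
  define M where "M = closed_loop_A A B C1 F G"
  \<comment> \<open>\<open>X\<close> is \<open>diag(Q, S)\<close> transformed back from the coordinates \<open>e\<close>, \<open>w\<close> to \<open>x\<close>, \<open>w\<close>.\<close>
  define X where "X = vblock (hblock (Q + S) S) (hblock S S)"
  have Qsym: "symmetric_matrix Q" using Q by (simp add: pos_def_def)
  have GT: "transpose G = C1 ** Q"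
    using Qsym by (simp add: G matrix_transpose_mul symmetric_matrix_def)
  have fst_X: "vec_fst (X *v v) = Q *v vec_fst v + S *v (vec_fst v + vec_snd v)"
    and snd_X: "vec_snd (X *v v) = S *v (vec_fst v + vec_snd v)" for v
    by (simp_all add: X_def hblock_mult_vec matrix_vector_mult_add_rdistrib matrix_vector_right_distrib)
  have X_form: "v \<bullet> (X *v v) = vec_fst v \<bullet> (Q *v vec_fst v)
      + (vec_fst v + vec_snd v) \<bullet> (S *v (vec_fst v + vec_snd v))" for v
    by (simp add: inner_vec_fst_snd fst_X snd_X inner_add_left inner_add_right)
  have "transpose Q = Q" "transpose S = S"
    using Qsym S(1) by (simp_all add: symmetric_matrix_def)
  then have "transpose X = X"
    unfolding matrix_eq[of "transpose X"]
    by (simp add: vec_fst_snd_eq_iff X_def transpose_vblock transpose_hblock hblock_mult_vec transpose_add)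
  then have "symmetric_matrix X" by (simp add: symmetric_matrix_def)
  moreover have "0 \<le> v \<bullet> (X *v v)" for v
    unfolding X_form by (intro add_nonneg_nonneg pos_def_nonneg[OF Q] S(2))
  moreover have "2 * ((transpose M *v v) \<bullet> (X *v v)) + (norm (transpose (closed_loop_E E D1 G) *v v))\<^sup>2 \<le> 0" for v
  proof -
    \<comment> \<open>As a functional on states, \<open>v\<close> has components \<open>p\<close>
      and \<open>p + q\<close> in the coordinates \<open>e\<close>, \<open>w\<close>; hence
      \<open>Q\<close> is evaluated at \<open>p\<close> and \<open>S\<close> at
      \<open>p + q\<close>.\<close>
    define p q where "p = vec_fst v" and "q = vec_snd v"
    define g where "g = transpose G *v q"
    have "(transpose M *v v) \<bullet> (X *v v) = (transpose A *v p) \<bullet> (Q *v p) + (transpose C1 *v g) \<bullet> (Q *v p)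
        + (transpose (A + B ** F) *v (p + q)) \<bullet> (S *v (p + q))"
      by (simp add: M_def closed_loop_A_def transpose_vblock transpose_hblock hblock_mult_vec
          inner_vec_fst_snd fst_X snd_X p_def[symmetric] q_def[symmetric] g_def transpose_add transpose_diff
          matrix_transpose_mul matrix_vector_mult_add_rdistrib matrix_vector_mult_diff_rdistrib
          matrix_vector_right_distrib matrix_vector_mul_assoc[symmetric]
          inner_add_left inner_add_right inner_diff_left algebra_simps)
    moreover have "(transpose C1 *v g) \<bullet> (Q *v p) = g \<bullet> (C1 *v (Q *v p))"
      by (simp add: inner_matrix_vector_mult_left)
    moreover have "2 * ((transpose (A + B ** F) *v (p + q)) \<bullet> (S *v (p + q))) = - (norm (C1 *v (Q *v p) + g))\<^sup>2"
    proof -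
      have "(p + q) \<bullet> ((G ** transpose G) *v (p + q)) = (norm (transpose G *v (p + q)))\<^sup>2"
        using inner_matrix_vector_mult_left[of "transpose G" "p + q" "transpose G *v (p + q)"]
        by (simp add: power2_norm_eq_inner matrix_vector_mul_assoc)
      moreover have "transpose G *v (p + q) = C1 *v (Q *v p) + g"
        by (simp add: g_def GT matrix_vector_right_distrib matrix_vector_mul_assoc)
      ultimately show ?thesis
        using lyapunov_equation_form[OF S(1) lyap, of "p + q"] by simp
    qed
    moreover have "(norm (C1 *v (Q *v p) + g))\<^sup>2
        = (norm (C1 *v (Q *v p)))\<^sup>2 + 2 * (g \<bullet> (C1 *v (Q *v p))) + (norm g)\<^sup>2"
      by (simp add: power2_norm_eq_inner inner_add_left inner_add_right inner_commute)
    \<comment> \<open>Process and measurement noise do not mix by \<open>orth\<close>, and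
      \<open>D1\<close> makes the measurement part exactly the squared norm of
      \<open>g\<close>.\<close>
    moreover have "(norm (transpose (closed_loop_E E D1 G) *v v))\<^sup>2 = (norm (transpose E *v p))\<^sup>2 + (norm g)\<^sup>2"
    proof -
      have "(transpose D1 *v g) \<bullet> (transpose E *v p) = g \<bullet> ((D1 ** transpose E) *v p)"
        by (simp add: inner_matrix_vector_mult_left matrix_vector_mul_assoc)
      then have "(transpose D1 *v g) \<bullet> (transpose E *v p) = 0" by (simp add: orth)
      moreover have "(transpose D1 *v g) \<bullet> (transpose D1 *v g) = g \<bullet> g"
        by (simp add: inner_matrix_vector_mult_left matrix_vector_mul_assoc D1)
      moreover have "transpose (closed_loop_E E D1 G) *v v = transpose E *v p + transpose D1 *v g"
        by (simp add: closed_loop_E_def transpose_vblock hblock_mult_vec p_def q_def g_def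
            matrix_transpose_mul matrix_vector_mul_assoc)
      ultimately show ?thesis
        by (simp add: power2_norm_eq_inner inner_add_left inner_add_right inner_commute)
    qed
    moreover have "2 * ((transpose A *v p) \<bullet> (Q *v p)) + (norm (transpose E *v p))\<^sup>2 \<le> (norm (C1 *v (Q *v p)))\<^sup>2"
      using filter_riccati_form[OF Qsym ric, of p] by (cases "p = 0") auto
    \<comment> \<open>The mixed term and the squared norm of \<open>g\<close> cancel against the
      expanded square, leaving the Riccati form at \<open>p\<close>.\<close>
    ultimately show ?thesis by (simp add: algebra_simps)
  qed
  ultimately have "H2_cost A B E C1 D1 C2 D2 F G
      \<le> ennreal (trace (closed_loop_C C2 D2 F ** X ** transpose (closed_loop_C C2 D2 F)))"
    unfolding H2_cost_def impulse_response_def M_def by (rule output_energy_le)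
  \<comment> \<open>On the rows of the output matrix, \<open>p\<close> is a row of \<open>C2\<close>
    and \<open>p + q\<close> a row of \<open>C2 + D2 ** F\<close>, so the trace splits.\<close>
  also have "trace (closed_loop_C C2 D2 F ** X ** transpose (closed_loop_C C2 D2 F))
      = trace (C2 ** Q ** transpose C2) + trace ((C2 + D2 ** F) ** S ** transpose (C2 + D2 ** F))"
    by (simp add: trace_congruence X_form closed_loop_C_def sum.distrib)
  finally show ?thesis .
qed

text \<open>Duality: by cyclicity, the trace of \<open>N ** S\<close> is the left trace minus the
  right one, and it is nonpositive because \<open>N\<close> is negative and \<open>S\<close>
  positive semidefinite.\<close>

lemma trace_lyapunov_le:
  fixes M P S K :: "real ^ 'n ^ 'n" and C :: "real ^ 'n ^ 'p"
  assumes P: "symmetric_matrix P"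
    and le: "\<And>x. 2 * (x \<bullet> (P *v (M *v x))) + (norm (C *v x))\<^sup>2 \<le> 0"
    and S: "symmetric_matrix S" "\<And>x. 0 \<le> x \<bullet> (S *v x)"
    and lyap: "M ** S + S ** transpose M + K = 0"
  shows "trace (C ** S ** transpose C) \<le> trace (P ** K)"
proof -
  define N where "N = transpose M ** P + P ** M + transpose C ** C"
  have "x \<bullet> (N *v x) \<le> 0" for x
  proof -
    have "x \<bullet> (transpose M *v (P *v x)) = x \<bullet> (P *v (M *v x))"
      using inner_matrix_vector_mult_left[of M x "P *v x"] symmetric_matrix_inner_swap[OF P, of "M *v x" x]
      by simp
    moreover have "x \<bullet> (transpose C *v (C *v x)) = (norm (C *v x))\<^sup>2"
      by (simp add: inner_matrix_vector_mult_left[symmetric] power2_norm_eq_inner)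
    ultimately show ?thesis
      using le[of x]
      by (simp add: N_def matrix_vector_mult_add_rdistrib matrix_vector_mul_assoc[symmetric] inner_add_right)
  qed
  then have "trace (N ** S) \<le> 0" by (rule trace_mult_nonpos_psd[OF _ S])
  moreover have "trace (transpose M ** P ** S) = trace (P ** (S ** transpose M))"
    using trace_mul_sym[of "transpose M" "P ** S"] by (simp add: matrix_mul_assoc)
  moreover have "trace (transpose C ** C ** S) = trace (C ** S ** transpose C)"
    using trace_mul_sym[of "transpose C" "C ** S"] by (simp add: matrix_mul_assoc)
  moreover have "trace (P ** (M ** S)) + trace (P ** (S ** transpose M)) + trace (P ** K) = 0"
  proof -
    have "trace (P ** (M ** S + S ** transpose M + K)) = 0"
      unfolding lyap by (simp add: trace_def)
    then show ?thesis by (simp add: matrix_add_ldistrib trace_add)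
  qed
  ultimately show ?thesis
    by (simp add: N_def matrix_add_rdistrib trace_add matrix_mul_assoc)
qed

theorem theorem4:
  fixes A :: "real ^ 'n ^ 'n" and B :: "real ^ 'm ^ 'n" and E :: "real ^ 'q ^ 'n"
    and C1 :: "real ^ 'n ^ 'r" and D1 :: "real ^ 'q ^ 'r"
    and C2 :: "real ^ 'n ^ 'p" and D2 :: "real ^ 'm ^ 'p"
    and P Q :: "real ^ 'n ^ 'n"
    and F :: "real ^ 'n ^ 'm" and G :: "real ^ 'r ^ 'n"
    and \<gamma> :: real
  assumes "stabilizable A B" and "detectable C1 A"
    and "\<gamma> > 0"
    and "D1 ** transpose E = 0" and "transpose D2 ** C2 = 0"
    and "D1 ** transpose D1 = mat 1" and "pos_def (transpose D2 ** D2)"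
    and "pos_def P" and "pos_def Q"
    and "neg_def (transpose A ** P + P ** A
           - P ** B ** matrix_inv (transpose D2 ** D2) ** transpose B ** P
           + transpose C2 ** C2)"
    and "neg_def (A ** Q + Q ** transpose A - Q ** transpose C1 ** C1 ** Q + E ** transpose E)"
    and "trace (C1 ** Q ** P ** Q ** transpose C1) + trace (C2 ** Q ** transpose C2) < \<gamma>"
    and "G = Q ** transpose C1"
    and "F = - (matrix_inv (transpose D2 ** D2) ** transpose B ** P)"
  shows "internally_stabilizes A B C1 F G \<and> H2_cost A B E C1 D1 C2 D2 F G < ennreal \<gamma>"
proof
  define M where "M = A + B ** F"
  have Psym: "symmetric_matrix P" and Qsym: "symmetric_matrix Q"
    using \<open>pos_def P\<close> \<open>pos_def Q\<close> by (simp_all add: pos_def_def)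
  note P_inv = pos_def_inverse[OF \<open>pos_def P\<close>] and Q_inv = pos_def_inverse[OF \<open>pos_def Q\<close>]
  have inv_swap: "x \<bullet> (matrix_inv W *v y) = (matrix_inv W *v x) \<bullet> y"
    if "pos_def (matrix_inv W)" for W :: "real ^ 'n ^ 'n" and x y
    using symmetric_matrix_inner_swap[of "matrix_inv W" x y] that by (simp add: pos_def_def inner_commute)
  have control: "2 * (x \<bullet> (P *v (M *v x))) + (norm ((C2 + D2 ** F) *v x))\<^sup>2 < 0" if "x \<noteq> 0" for x
    unfolding M_def by (rule control_riccati_form[OF assms(5,7) Psym assms(10,14) that])
  have P_neg: "x \<bullet> (P *v (M *v x)) < 0" if "x \<noteq> 0" for x
    using control[OF that] zero_le_power2[of "norm ((C2 + D2 ** F) *v x)"] by linarith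
  have GT: "transpose G = C1 ** Q"
    using Qsym by (simp add: \<open>G = _\<close> matrix_transpose_mul symmetric_matrix_def)
  show "internally_stabilizes A B C1 F G"
  proof (rule separation_principle[OF Q_inv(3) _ \<open>pos_def P\<close> P_neg[unfolded M_def]])
    fix x :: "real ^ 'n"
    assume "x \<noteq> 0"
    \<comment> \<open>The filter inequality concerns \<open>transpose (A - G ** C1)\<close> with
      weight \<open>Q\<close>; this substitution turns it into one for \<open>A - G ** C1\<close>
      with weight \<open>matrix_inv Q\<close>.\<close>
    define y where "y = matrix_inv Q *v x"
    have Qy: "Q *v y = x" by (simp add: y_def matrix_vector_mul_assoc Q_inv)
    then have "y \<noteq> 0" using \<open>x \<noteq> 0\<close> by auto
    have "x \<bullet> (matrix_inv Q *v ((A - G ** C1) *v x)) = y \<bullet> ((A - G ** C1) *v x)"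
      by (simp add: inv_swap[OF Q_inv(3)] y_def)
    also have "\<dots> = (transpose A *v y) \<bullet> x - (transpose G *v y) \<bullet> (C1 *v x)"
      using inner_matrix_vector_mult_left[of "transpose A" y x]
        inner_matrix_vector_mult_left[of "transpose G" y "C1 *v x"]
      by (simp add: matrix_vector_mult_diff_rdistrib matrix_vector_mul_assoc[symmetric] inner_diff_right)
    also have "\<dots> = (transpose A *v y) \<bullet> (Q *v y) - (norm (C1 *v (Q *v y)))\<^sup>2"
      by (simp add: GT Qy matrix_vector_mul_assoc[symmetric] power2_norm_eq_inner)
    also have "\<dots> < 0"
      using filter_riccati_form[OF Qsym assms(11) \<open>y \<noteq> 0\<close>] zero_le_power2[of "norm (transpose E *v y)"]
        zero_le_power2[of "norm (C1 *v (Q *v y))"] by linarith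
    finally show "x \<bullet> (matrix_inv Q *v ((A - G ** C1) *v x)) < 0" .
  qed
  \<comment> \<open>The equation for \<open>S\<close> calls for a Lyapunov matrix of
    \<open>transpose M\<close>, so the weight is \<open>matrix_inv P\<close> and the substitution
    goes the other way.\<close>
  have neg: "(transpose M *v x) \<bullet> (matrix_inv P *v x) < 0" if "x \<noteq> 0" for x
  proof -
    define y where "y = matrix_inv P *v x"
    have Py: "P *v y = x" by (simp add: y_def matrix_vector_mul_assoc P_inv)
    then have "y \<noteq> 0" using \<open>x \<noteq> 0\<close> by auto
    have "(transpose M *v x) \<bullet> y = x \<bullet> (M *v y)"
      by (simp add: inner_matrix_vector_mult_left)
    also have "\<dots> = y \<bullet> (P *v (M *v y))"
      using symmetric_matrix_inner_swap[OF Psym, of y "M *v y"] by (simp add: Py inner_commute)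
    also have "\<dots> < 0" by (rule P_neg[OF \<open>y \<noteq> 0\<close>])
    finally show ?thesis by (simp add: y_def)
  qed
  have "symmetric_matrix (G ** transpose G)"
    by (simp add: symmetric_matrix_def matrix_transpose_mul)
  moreover have "0 \<le> x \<bullet> ((G ** transpose G) *v x)" for x
    using inner_matrix_vector_mult_left[of "transpose G" x "transpose G *v x"]
    by (metis inner_ge_zero matrix_vector_mul_assoc transpose_transpose)
  ultimately obtain S where S: "symmetric_matrix S" "\<And>x. 0 \<le> x \<bullet> (S *v x)"
    and lyap: "M ** S + S ** transpose M + G ** transpose G = 0"
    using lyapunov_equation_solvable[OF P_inv(3) neg] by metis
  have "2 * (x \<bullet> (P *v (M *v x))) + (norm ((C2 + D2 ** F) *v x))\<^sup>2 \<le> 0" for x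
    using control[of x] by (cases "x = 0") auto
  then have "trace ((C2 + D2 ** F) ** S ** transpose (C2 + D2 ** F)) \<le> trace (P ** (G ** transpose G))"
    by (rule trace_lyapunov_le[OF Psym _ S lyap])
  also have "\<dots> = trace ((C1 ** Q) ** (P ** G))"
    unfolding GT[symmetric] matrix_mul_assoc[of P] by (rule trace_mul_sym)
  also have "\<dots> = trace (C1 ** Q ** P ** Q ** transpose C1)"
    by (simp add: \<open>G = _\<close> matrix_mul_assoc)
  finally have "trace (C2 ** Q ** transpose C2)
      + trace ((C2 + D2 ** F) ** S ** transpose (C2 + D2 ** F)) < \<gamma>"
    using assms(12) by linarith
  then have "ennreal (trace (C2 ** Q ** transpose C2)
      + trace ((C2 + D2 ** F) ** S ** transpose (C2 + D2 ** F))) < ennreal \<gamma>"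
    \<comment> \<open>Positivity of \<gamma> keeps the inequality strict in the extended nonnegative
      reals.\<close>
    using \<open>\<gamma> > 0\<close> by (simp add: ennreal_lessI)
  then show "H2_cost A B E C1 D1 C2 D2 F G < ennreal \<gamma>"
    using H2_cost_le[OF assms(4,6,9,11,13) S lyap[unfolded M_def], of C2 D2]
    by (rule order.strict_trans1[rotated])
qed

end
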